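(* Let $R$ be a commutative ring, let $n$ be a positive integer and let $\precsim$ be a preorder on $\{1,\ldots,n\}$. Then the set $\operatorname{N}_{\mathrm{M}_{\precsim}(R)}(\mathrm{M}_{\precsim}(R))$ of null polynomials with coefficients in $\mathrm{M}_{\precsim}(R)$ is a two-sided ideal of $\mathrm{M}_{\precsim}(R)[x]$. Moreover, when its elements are viewed as matrices whose entries are polynomials with scalar coefficients (via $\mathrm{M}_{\precsim}(R)[x]\cong \mathrm{M}_{\precsim}(R[x])$), $$\operatorname{N}_{\mathrm{M}_{\precsim}(R)}(\mathrm{M}_{\precsim}(R))=\left\{(f_{ih})\in \mathrm{M}_{\precsim}(R[x]) \;\middle|\; f_{ih}\in \operatorname{N}_R\left(\mathrm{M}_{\precsim}(R)^{[h,\infty)}\right)\text{ for every } i,h \text{ with } i\precsim h\right\}.$$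
   Context: All rings are unital, subrings share the same identity, and polynomial rings are taken in a central indeterminate $x$. For a commutative ring $R$, a positive integer $n$ and a preorder (reflexive transitive relation) $\precsim$ on $\{1,\ldots,n\}$, the structural matrix ring is $\mathrm{M}_{\precsim}(R)=\{(a_{ij})\in \mathrm{M}_n(R)\mid a_{ij}\neq 0\Rightarrow i\precsim j\}$, a subring of the ring $\mathrm{M}_n(R)$ of $n\times n$ matrices over $R$. Isomorphism: a polynomial $f=\sum_{k=0}^m F_kx^k\in \mathrm{M}_{\precsim}(R)[x]$ with $F_k=(f^{(k)}_{ij})$ is identified with the matrix $(f_{ij})\in \mathrm{M}_{\precsim}(R[x])$, where $f_{ij}=\sum_{k=0}^m f^{(k)}_{ij}x^k\in R[x]$. Evaluation is right substitution: for $f=\sum_k F_kx^k\in \mathrm{M}_{\precsim}(R)[x]$ and $A\in \mathrm{M}_{\precsim}(R)$, $f(A)=\sum_k F_kA^k$. $\operatorname{N}_{\mathrm{M}_{\precsim}(R)}(\mathrm{M}_{\precsim}(R))=\{f\in \mathrm{M}_{\precsim}(R)[x]\mid \forall A\in \mathrm{M}_{\precsim}(R):\ f(A)=0\}$. For $h\in\{1,\ldots,n\}$ let $[h,\infty)=\{k\in\{1,\ldots,n\}\mid h\precsim k\}$. For an $n\times n$ matrix $A$, $A^{[h,\infty)}$ is the $n\times n$ matrix obtained from $A$ by replacing every entry whose row or column index is outside $[h,\infty)$ with zero, and $\mathrm{M}_{\precsim}(R)^{[h,\infty)}=\{A^{[h,\infty)}\mid A\in \mathrm{M}_{\precsim}(R)\}$.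 This is a ring with identity $I_n^{[h,\infty)}$ (where $I_n$ is the identity matrix), and when evaluating a scalar polynomial in $R[x]$ at an element $A$ of $\mathrm{M}_{\precsim}(R)^{[h,\infty)}$ one uses the convention $A^0:=I_n^{[h,\infty)}$. $\operatorname{N}_R(\mathrm{M}_{\precsim}(R)^{[h,\infty)})=\{f\in R[x]\mid \forall A\in \mathrm{M}_{\precsim}(R)^{[h,\infty)}:\ f(A)=0\}$. *)

theory Defs
  imports "HOL-Algebra.UnivPoly"
begin

text \<open>
  An \<open>n \<times> n\<close> matrix is a function on pairs of indices from \<open>{1..n}\<close>, extended by zero to all
  other arguments, so that equality of functions is equality of matrices.
\<close>

definition mat_ring :: "nat \<Rightarrow> ('a, 'm) ring_scheme \<Rightarrow> (nat \<Rightarrow> nat \<Rightarrow> 'a) ring" where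
  "mat_ring n R = \<lparr>
     carrier = {A. (\<forall>i\<in>{1..n}. \<forall>j\<in>{1..n}. A i j \<in> carrier R) \<and>
                   (\<forall>i j. i \<notin> {1..n} \<or> j \<notin> {1..n} \<longrightarrow> A i j = \<zero>\<^bsub>R\<^esub>)},
     mult = (\<lambda>A B i j. if i \<in> {1..n} \<and> j \<in> {1..n}
                        then \<Oplus>\<^bsub>R\<^esub>k\<in>{1..n}. A i k \<otimes>\<^bsub>R\<^esub> B k j else \<zero>\<^bsub>R\<^esub>),
     one = (\<lambda>i j. if i \<in> {1..n} \<and> i = j then \<one>\<^bsub>R\<^esub> else \<zero>\<^bsub>R\<^esub>),
     zero = (\<lambda>i j. \<zero>\<^bsub>R\<^esub>),
     add = (\<lambda>A B i j. A i j \<oplus>\<^bsub>R\<^esub> B i j)\<rparr>"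

definition struct_mat_ring ::
  "nat \<Rightarrow> (nat \<times> nat) set \<Rightarrow> ('a, 'm) ring_scheme \<Rightarrow> (nat \<Rightarrow> nat \<Rightarrow> 'a) ring" where
  "struct_mat_ring n r R = (mat_ring n R)
     \<lparr>carrier := {A \<in> carrier (mat_ring n R).
        \<forall>i\<in>{1..n}. \<forall>j\<in>{1..n}. A i j \<noteq> \<zero>\<^bsub>R\<^esub> \<longrightarrow> (i, j) \<in> r}\<rparr>"

text \<open>
  The matrix over \<open>R[x]\<close> corresponding to a polynomial \<open>f\<close> with matrix coefficients \<open>F\<^sub>k\<close>; its
  \<open>(i, j)\<close> entry is the sum of the monomials \<open>(F\<^sub>k)\<^sub>i\<^sub>j x\<^sup>k\<close>.
\<close>

definition poly_to_mat ::
  "nat \<Rightarrow> (nat \<times> nat) set \<Rightarrow> ('a, 'm) ring_scheme \<Rightarrow>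
   (nat \<Rightarrow> nat \<Rightarrow> nat \<Rightarrow> 'a) \<Rightarrow> (nat \<Rightarrow> nat \<Rightarrow> nat \<Rightarrow> 'a)" where
  "poly_to_mat n r R f = (\<lambda>i j. \<Oplus>\<^bsub>UP R\<^esub>k\<in>{..deg (struct_mat_ring n r R) f}.
     monom (UP R) (coeff (UP (struct_mat_ring n r R)) f k i j) k)"

text \<open>
  With identity coefficient map, \<^const>\<open>eval\<close> places the coefficients to the left of the powers of
  the argument, which is right substitution.
\<close>

definition null_mat_polys ::
  "nat \<Rightarrow> (nat \<times> nat) set \<Rightarrow> ('a, 'm) ring_scheme \<Rightarrow> (nat \<Rightarrow> nat \<Rightarrow> nat \<Rightarrow> 'a) set" where
  "null_mat_polys n r R = (let M = struct_mat_ring n r R in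
     {f \<in> carrier (UP M). \<forall>A \<in> carrier M. eval M M id A f = \<zero>\<^bsub>M\<^esub>})"

definition up_interval :: "nat \<Rightarrow> (nat \<times> nat) set \<Rightarrow> nat \<Rightarrow> nat set" where
  "up_interval n r h = {k \<in> {1..n}. (h, k) \<in> r}"

definition mat_restrict ::
  "('a, 'm) ring_scheme \<Rightarrow> nat set \<Rightarrow> (nat \<Rightarrow> nat \<Rightarrow> 'a) \<Rightarrow> (nat \<Rightarrow> nat \<Rightarrow> 'a)" where
  "mat_restrict R S A = (\<lambda>i j. if i \<in> S \<and> j \<in> S then A i j else \<zero>\<^bsub>R\<^esub>)"

text \<open>
  The identity of this ring is the restricted identity matrix, so powers \<open>[^]\<close> taken in it have
  the restricted identity matrix as zeroth power.
\<close>

definition restricted_ring ::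
  "nat \<Rightarrow> (nat \<times> nat) set \<Rightarrow> ('a, 'm) ring_scheme \<Rightarrow> nat \<Rightarrow> (nat \<Rightarrow> nat \<Rightarrow> 'a) ring" where
  "restricted_ring n r R h = (struct_mat_ring n r R)
     \<lparr>carrier := mat_restrict R (up_interval n r h) ` carrier (struct_mat_ring n r R),
      one := mat_restrict R (up_interval n r h) \<one>\<^bsub>struct_mat_ring n r R\<^esub>\<rparr>"

definition scalar_mult_mat ::
  "('a, 'm) ring_scheme \<Rightarrow> 'a \<Rightarrow> (nat \<Rightarrow> nat \<Rightarrow> 'a) \<Rightarrow> (nat \<Rightarrow> nat \<Rightarrow> 'a)" where
  "scalar_mult_mat R c A = (\<lambda>i j. c \<otimes>\<^bsub>R\<^esub> A i j)"

definition scalar_poly_eval ::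
  "nat \<Rightarrow> (nat \<times> nat) set \<Rightarrow> ('a, 'm) ring_scheme \<Rightarrow> nat \<Rightarrow>
   (nat \<Rightarrow> nat \<Rightarrow> 'a) \<Rightarrow> (nat \<Rightarrow> 'a) \<Rightarrow> (nat \<Rightarrow> nat \<Rightarrow> 'a)" where
  "scalar_poly_eval n r R h A f = (\<Oplus>\<^bsub>restricted_ring n r R h\<^esub>k\<in>{..deg R f}.
     scalar_mult_mat R (coeff (UP R) f k) (A [^]\<^bsub>restricted_ring n r R h\<^esub> k))"

definition null_scalar_polys ::
  "nat \<Rightarrow> (nat \<times> nat) set \<Rightarrow> ('a, 'm) ring_scheme \<Rightarrow> nat \<Rightarrow> (nat \<Rightarrow> 'a) set" where
  "null_scalar_polys n r R h = {f \<in> carrier (UP R).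
     \<forall>A \<in> carrier (restricted_ring n r R h).
       scalar_poly_eval n r R h A f = \<zero>\<^bsub>restricted_ring n r R h\<^esub>}"

end

theory Submission
  imports Defs "HOL-Algebra.QuotRing"
begin

text \<open>
  Write \<open>M\<close> for the structural matrix ring. Left multiplication preserves null polynomials over any ring,
  because right substitution gives \<open>(c x\<^sup>l f)(A) = c f(A) A\<^sup>l\<close>. Right multiplication is the problem: over
  a noncommutative ring \<open>(f c)(A)\<close> is the sum of the \<open>F\<^sub>k c A\<^sup>k\<close>, which is not determined by \<open>f(A)\<close>
  alone. The proof studies the set of constants \<open>c\<close> for which \<open>f c\<close> is null whenever \<open>f\<close> is; call them
  null multipliers. They are closed under sums and products, and they contain

  \<^item> the central elements, where \<open>(f c)(A) = f(A) c\<close>;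
  \<^item> the left invertible elements: if \<open>v u = 1\<close>, then \<open>(f u)(A) = f(u A v) u\<close>. Applied to \<open>1 + x\<close>
    this yields every \<open>x\<close> with \<open>x\<^sup>2 = 0\<close>;
  \<^item> the elements \<open>e\<close> with \<open>e b e = e b\<close> for all \<open>b\<close>, where \<open>(f e)(A) = f(e A) + f(0)(e - 1)\<close>.

  In \<open>M\<close> the matrix units \<open>E\<^sub>p\<^sub>q\<close> with \<open>p \<noteq> q\<close> have square zero. A diagonal unit \<open>E\<^sub>p\<^sub>p\<close> is either a product
  \<open>E\<^sub>p\<^sub>j E\<^sub>j\<^sub>p\<close> of two of these or, when \<open>p\<close> is equivalent to no other index, the difference of the
  diagonal idempotents of the upward closed sets \<open>[p, \<infinity>)\<close> and \<open>[p, \<infinity>) - {p}\<close>, both of the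
  third kind. Together with the scalar matrices these generate \<open>M\<close>, so every constant is a null
  multiplier (\<open>null_multipliers_eq_carrier\<close>), and the ideal property follows (\<open>null_polys_ideal\<close>).

  The same fact separates the entries of \<open>f\<close>. The \<open>(i, j)\<close> entry of \<open>f(A)\<close> is the sum over \<open>h\<close> of
  the \<open>(h, j)\<close> entries of \<open>f\<^sub>i\<^sub>h(A)\<close>, and passing from \<open>f\<close> to the null polynomial \<open>f E\<^sub>h\<^sub>a\<close> isolates
  the \<open>(a, j)\<close> entry of \<open>f\<^sub>i\<^sub>h(A)\<close> for every \<open>a\<close> with \<open>h \<precsim> a\<close>
  (\<open>null_polys_entry\<close>). Finally, cutting a matrix down to \<open>[h, \<infinity>)\<close> is a
  ring homomorphism, because \<open>[h, \<infinity>)\<close> is upward closed; hence a scalar polynomial is null on the cut matrices exactly when its values on \<open>M\<close> have zero rows at all \<open>a\<close>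
  with \<open>h \<precsim> a\<close> (\<open>null_scalar_polys_iff\<close>).
\<close>

section \<open>Right substitution\<close>

text \<open>
  The map \<open>eval R R id a\<close>, without the detour through the identity function. It is additive in the
  polynomial, but not multiplicative unless \<open>a\<close> is central.
\<close>
definition right_eval :: "('a, 'm) ring_scheme \<Rightarrow> 'a \<Rightarrow> (nat \<Rightarrow> 'a) \<Rightarrow> 'a" where
  "right_eval R a f = (\<Oplus>\<^bsub>R\<^esub>k\<in>{..deg R f}. coeff (UP R) f k \<otimes>\<^bsub>R\<^esub> a [^]\<^bsub>R\<^esub> k)"

definition null_polys :: "('a, 'm) ring_scheme \<Rightarrow> (nat \<Rightarrow> 'a) set" where
  "null_polys R = {f \<in> carrier (UP R). \<forall>a \<in> carrier R. right_eval R a f = \<zero>\<^bsub>R\<^esub>}"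

definition null_multipliers :: "('a, 'm) ring_scheme \<Rightarrow> 'a set" where
  "null_multipliers R =
     {c \<in> carrier R. \<forall>f \<in> null_polys R. f \<otimes>\<^bsub>UP R\<^esub> monom (UP R) c 0 \<in> null_polys R}"

context UP_ring
begin

text \<open>
  The value of a product is not the product of the values, but for each product needed below there is
  a formula that is additive in one factor and can therefore be checked on monomials.
\<close>
lemma poly_induct_monom [consumes 1, case_names zero monom add]:
  assumes "f \<in> carrier P"
    and zero: "Q \<zero>\<^bsub>P\<^esub>"
    and monom: "\<And>c k. c \<in> carrier R \<Longrightarrow> Q (monom P c k)"
    and add: "\<And>f g. f \<in> carrier P \<Longrightarrow> g \<in> carrier P \<Longrightarrow> Q f \<Longrightarrow> Q g \<Longrightarrow> Q (f \<oplus>\<^bsub>P\<^esub> g)"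
  shows "Q f"
proof -
  have "Q (\<Oplus>\<^bsub>P\<^esub>i\<in>I. monom P (coeff P f i) i)" if "finite I" for I
    using that
  proof (induction I)
    case empty
    then show ?case using zero by simp
  next
    case (insert i I)
    then show ?case
      using assms(1) by (simp add: Pi_def add monom)
  qed
  from this[of "{..deg R f}"] show ?thesis
    using up_repr[OF assms(1)] by simp
qed

lemma right_eval_eq_finsum:
  assumes f: "f \<in> carrier P" and a: "a \<in> carrier R" and le: "deg R f \<le> m"
  shows "right_eval R a f = (\<Oplus>k\<in>{..m}. coeff P f k \<otimes> a [^] k)"
proof -
  have "(\<Oplus>k\<in>{..deg R f}. coeff P f k \<otimes> a [^] k) = (\<Oplus>k\<in>{..m}. coeff P f k \<otimes> a [^] k)"
    using f a le
    by (intro R.add.finprod_mono_neutral_cong_left) (auto simp: deg_aboveD)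
  then show ?thesis
    by (simp add: right_eval_def P_def)
qed

lemma right_eval_closed:
  assumes "f \<in> carrier P" and "a \<in> carrier R"
  shows "right_eval R a f \<in> carrier R"
  using assms by (simp add: right_eval_def Pi_def flip: P_def)

lemma right_eval_zero:
  assumes "a \<in> carrier R"
  shows "right_eval R a \<zero>\<^bsub>P\<^esub> = \<zero>"
  using assms by (simp add: right_eval_def flip: P_def)

lemma right_eval_add:
  assumes f: "f \<in> carrier P" and g: "g \<in> carrier P" and a: "a \<in> carrier R"
  shows "right_eval R a (f \<oplus>\<^bsub>P\<^esub> g) = right_eval R a f \<oplus> right_eval R a g"
proof -
  let ?m = "max (deg R f) (deg R g)"
  have "right_eval R a (f \<oplus>\<^bsub>P\<^esub> g) = (\<Oplus>k\<in>{..?m}. coeff P (f \<oplus>\<^bsub>P\<^esub> g) k \<otimes> a [^] k)"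
    using assms by (intro right_eval_eq_finsum) auto
  also have "\<dots> = (\<Oplus>k\<in>{..?m}. coeff P f k \<otimes> a [^] k \<oplus> coeff P g k \<otimes> a [^] k)"
    using assms by (intro R.finsum_cong') (auto simp: R.l_distr)
  also have "\<dots> = right_eval R a f \<oplus> right_eval R a g"
    using assms right_eval_eq_finsum[OF f a, of ?m] right_eval_eq_finsum[OF g a, of ?m]
    by (simp add: R.finsum_addf Pi_def)
  finally show ?thesis .
qed

lemma right_eval_monom:
  assumes c: "c \<in> carrier R" and a: "a \<in> carrier R"
  shows "right_eval R a (monom P c k) = c \<otimes> a [^] k"
proof -
  have "right_eval R a (monom P c k) = (\<Oplus>i\<in>{..k}. coeff P (monom P c k) i \<otimes> a [^] i)"
    using assms by (intro right_eval_eq_finsum) (auto simp: deg_monom_le)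
  also have "\<dots> = (\<Oplus>i\<in>{..k}. if k = i then c \<otimes> a [^] i else \<zero>)"
    using assms by (intro R.finsum_cong') auto
  also have "\<dots> = c \<otimes> a [^] k"
    using assms by (simp add: R.finsum_singleton)
  finally show ?thesis .
qed

lemma right_eval_monom_mult:
  assumes f: "f \<in> carrier P" and c: "c \<in> carrier R" and a: "a \<in> carrier R"
  shows "right_eval R a (monom P c l \<otimes>\<^bsub>P\<^esub> f) = c \<otimes> right_eval R a f \<otimes> a [^] l"
  using f
proof (induction f rule: poly_induct_monom)
  case zero
  then show ?case using c a by (simp add: right_eval_zero)
next
  case (monom b k)
  then show ?case
    using c a
    by (simp add: right_eval_monom R.m_assoc R.nat_pow_mult add.commute flip: monom_mult)
next
  case (add f g)
  then show ?case
    using c a by (simp add: right_eval_add right_eval_closed P.r_distr R.l_distr R.r_distr)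
qed

lemma right_eval_mult_X_pow:
  assumes f: "f \<in> carrier P" and a: "a \<in> carrier R"
  shows "right_eval R a (f \<otimes>\<^bsub>P\<^esub> monom P \<one> l) = right_eval R a f \<otimes> a [^] l"
  using f
proof (induction f rule: poly_induct_monom)
  case zero
  then show ?case using a by (simp add: right_eval_zero)
next
  case (monom b k)
  then show ?case
    using a
    by (simp add: right_eval_monom R.m_assoc R.nat_pow_mult flip: monom_mult)
next
  case (add f g)
  then show ?case
    using a by (simp add: right_eval_add right_eval_closed P.l_distr R.l_distr)
qed

text \<open>
  Since \<open>u a\<^sup>k = (u a v)\<^sup>k u\<close>, a left invertible constant moves past the powers of the argument at the
  price of changing the argument.
\<close>
lemma right_eval_mult_const_unit:
  assumes f: "f \<in> carrier P" and a: "a \<in> carrier R"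
    and u: "u \<in> carrier R" and v: "v \<in> carrier R" and vu: "v \<otimes> u = \<one>"
  shows "right_eval R a (f \<otimes>\<^bsub>P\<^esub> monom P u 0) = right_eval R (u \<otimes> a \<otimes> v) f \<otimes> u"
proof -
  have pow: "(u \<otimes> a \<otimes> v) [^] k \<otimes> u = u \<otimes> a [^] k" for k :: nat
  proof (induction k)
    case (Suc k)
    have "(u \<otimes> a \<otimes> v) [^] Suc k \<otimes> u = (u \<otimes> a \<otimes> v) [^] k \<otimes> u \<otimes> a \<otimes> (v \<otimes> u)"
      using a u v by (simp add: R.m_assoc)
    also have "\<dots> = u \<otimes> a [^] Suc k"
      using a u Suc vu by (simp add: R.m_assoc)
    finally show ?case .
  qed (use u in simp)
  show ?thesis
    using f
  proof (induction f rule: poly_induct_monom)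
    case zero
    then show ?case using a u v by (simp add: right_eval_zero)
  next
    case (monom c k)
    then show ?case
      using a u v pow[of k]
      by (simp add: right_eval_monom R.m_assoc flip: monom_mult)
  next
    case (add f g)
    then show ?case
      using a u v by (simp add: right_eval_add right_eval_closed P.l_distr R.l_distr)
  qed
qed

lemma right_eval_mult_const_commuting:
  assumes f: "f \<in> carrier P" and a: "a \<in> carrier R" and c: "c \<in> carrier R"
    and comm: "c \<otimes> a = a \<otimes> c"
  shows "right_eval R a (f \<otimes>\<^bsub>P\<^esub> monom P c 0) = right_eval R a f \<otimes> c"
  using f
proof (induction f rule: poly_induct_monom)
  case zero
  then show ?case using a c by (simp add: right_eval_zero)
next
  case (monom b k)
  have "a [^] k \<otimes> c = c \<otimes> a [^] k"
    using R.group_commutes_pow[of a c k] a c comm by simp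
  with monom show ?case
    using a c by (simp add: right_eval_monom R.m_assoc flip: monom_mult)
next
  case (add f g)
  then show ?case
    using a c by (simp add: right_eval_add right_eval_closed P.l_distr R.l_distr)
qed

text \<open>
  The hypothesis gives \<open>(e a)\<^sup>k = e a\<^sup>k\<close> for \<open>k \<ge> 1\<close>, so that substituting \<open>e a\<close> has the wanted effect on all
  terms except the constant one; the value at zero corrects that term.
\<close>
lemma right_eval_mult_const_corner:
  assumes f: "f \<in> carrier P" and a: "a \<in> carrier R" and e: "e \<in> carrier R"
    and corner: "\<And>b. b \<in> carrier R \<Longrightarrow> e \<otimes> b \<otimes> e = e \<otimes> b"
  shows "right_eval R a (f \<otimes>\<^bsub>P\<^esub> monom P e 0) =
    right_eval R (e \<otimes> a) f \<oplus> right_eval R \<zero> f \<otimes> (e \<ominus> \<one>)"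
proof -
  have pow: "(e \<otimes> a) [^] Suc k = e \<otimes> a [^] Suc k" for k :: nat
  proof (induction k)
    case (Suc k)
    have "(e \<otimes> a) [^] Suc (Suc k) = (e \<otimes> a [^] Suc k \<otimes> e) \<otimes> a"
      using a e Suc by (simp add: R.m_assoc)
    also have "\<dots> = e \<otimes> a [^] Suc k \<otimes> a"
      using a e corner[of "a [^] Suc k"] by simp
    finally show ?case
      using a e by (simp add: R.m_assoc)
  qed (use a e in simp)
  show ?thesis
    using f
  proof (induction f rule: poly_induct_monom)
    case zero
    then show ?case using a e by (simp add: right_eval_zero)
  next
    case (monom c k)
    show ?case
    proof (cases k)
      case 0
      have "c \<oplus> c \<otimes> (e \<ominus> \<one>) = c \<otimes> e"
        using monom e
        by (simp add: R.minus_eq R.r_distr R.r_minus R.a_ac R.r_neg2 R.r_neg1)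
      then show ?thesis
        using monom a e 0 by (simp add: right_eval_monom flip: monom_mult)
    next
      case (Suc l)
      have "(e \<otimes> a) [^] k = e \<otimes> a [^] k"
        using pow Suc by simp
      moreover have "\<zero> [^] k = \<zero>"
        using Suc by (simp add: R.nat_pow_zero)
      ultimately show ?thesis
        using monom a e by (simp add: right_eval_monom R.m_assoc flip: monom_mult)
    qed
  next
    case (add f g)
    then show ?case
      using a e by (simp add: right_eval_add right_eval_closed P.l_distr R.l_distr R.a_ac)
  qed
qed

section \<open>Null polynomials and null multipliers\<close>
lemma null_polys_iff:
  "f \<in> null_polys R \<longleftrightarrow> f \<in> carrier P \<and> (\<forall>a\<in>carrier R. right_eval R a f = \<zero>)"
  by (simp add: null_polys_def P_def)

lemma null_multipliers_iff:
  "c \<in> null_multipliers R \<longleftrightarrow>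
     c \<in> carrier R \<and> (\<forall>f\<in>null_polys R. f \<otimes>\<^bsub>P\<^esub> monom P c 0 \<in> null_polys R)"
  by (simp add: null_multipliers_def P_def)

lemma null_polys_zero: "\<zero>\<^bsub>P\<^esub> \<in> null_polys R"
  by (simp add: null_polys_iff right_eval_zero)

lemma null_polys_add:
  "f \<in> null_polys R \<Longrightarrow> g \<in> null_polys R \<Longrightarrow> f \<oplus>\<^bsub>P\<^esub> g \<in> null_polys R"
  by (simp add: null_polys_iff right_eval_add)

lemma null_polys_left_mult:
  assumes f: "f \<in> null_polys R" and g: "g \<in> carrier P"
  shows "g \<otimes>\<^bsub>P\<^esub> f \<in> null_polys R"
  using g
proof (induction g rule: poly_induct_monom)
  case zero
  then show ?case using f by (simp add: null_polys_iff right_eval_zero)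
next
  case (monom c k)
  then show ?case using f by (simp add: null_polys_iff right_eval_monom_mult)
next
  case (add g h)
  then show ?case
    using f null_polys_add by (simp add: null_polys_iff P.l_distr)
qed

lemma null_multipliers_subset: "null_multipliers R \<subseteq> carrier R"
  by (auto simp: null_multipliers_iff)

lemma null_multipliers_zero: "\<zero> \<in> null_multipliers R"
  using null_polys_zero by (auto simp: null_multipliers_iff null_polys_iff)

lemma null_multipliers_add:
  assumes "c \<in> null_multipliers R" and "d \<in> null_multipliers R"
  shows "c \<oplus> d \<in> null_multipliers R"
  unfolding null_multipliers_iff
proof (intro conjI ballI)
  fix f assume f: "f \<in> null_polys R"
  then have "f \<otimes>\<^bsub>P\<^esub> monom P (c \<oplus> d) 0 = f \<otimes>\<^bsub>P\<^esub> monom P c 0 \<oplus>\<^bsub>P\<^esub> f \<otimes>\<^bsub>P\<^esub> monom P d 0"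
    using assms by (simp add: null_multipliers_iff null_polys_iff P.r_distr)
  then show "f \<otimes>\<^bsub>P\<^esub> monom P (c \<oplus> d) 0 \<in> null_polys R"
    using f assms by (simp add: null_multipliers_iff null_polys_add)
qed (use assms in \<open>simp add: null_multipliers_iff\<close>)

lemma null_multipliers_mult:
  assumes "c \<in> null_multipliers R" and "d \<in> null_multipliers R"
  shows "c \<otimes> d \<in> null_multipliers R"
  unfolding null_multipliers_iff
proof (intro conjI ballI)
  fix f assume f: "f \<in> null_polys R"
  then have "f \<otimes>\<^bsub>P\<^esub> monom P (c \<otimes> d) 0 = (f \<otimes>\<^bsub>P\<^esub> monom P c 0) \<otimes>\<^bsub>P\<^esub> monom P d 0"
    using assms monom_mult[of c d 0 0]
    by (simp add: null_multipliers_iff null_polys_iff P.m_assoc)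
  then show "f \<otimes>\<^bsub>P\<^esub> monom P (c \<otimes> d) 0 \<in> null_polys R"
    using f assms by (simp add: null_multipliers_iff)
qed (use assms in \<open>simp add: null_multipliers_iff\<close>)

lemma null_multipliers_finsum:
  assumes "finite I" and "\<And>i. i \<in> I \<Longrightarrow> c i \<in> null_multipliers R"
  shows "(\<Oplus>i\<in>I. c i) \<in> null_multipliers R"
  using assms
proof (induction I)
  case empty
  then show ?case by (simp add: null_multipliers_zero)
next
  case (insert i I)
  moreover have "c \<in> insert i I \<rightarrow> carrier R"
    using insert.prems null_multipliers_subset by blast
  ultimately show ?case by (simp add: null_multipliers_add)
qed

lemma null_multipliers_central:
  assumes "c \<in> carrier R" and "\<And>a. a \<in> carrier R \<Longrightarrow> c \<otimes> a = a \<otimes> c"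
  shows "c \<in> null_multipliers R"
  using assms by (auto simp: null_multipliers_iff null_polys_iff right_eval_mult_const_commuting)

lemma null_multipliers_minus:
  assumes c: "c \<in> null_multipliers R"
  shows "\<ominus> c \<in> null_multipliers R"
proof -
  have "\<ominus> \<one> \<in> null_multipliers R"
    by (rule null_multipliers_central) (simp_all add: R.l_minus R.r_minus)
  then have "\<ominus> \<one> \<otimes> c \<in> null_multipliers R"
    using c by (rule null_multipliers_mult)
  moreover have "c \<in> carrier R"
    using c null_multipliers_subset by blast
  ultimately show ?thesis by (simp add: R.l_minus)
qed

lemma null_multipliers_unit:
  assumes "u \<in> carrier R" and "v \<in> carrier R" and "v \<otimes> u = \<one>"
  shows "u \<in> null_multipliers R"
  using assms by (auto simp: null_multipliers_iff null_polys_iff right_eval_mult_const_unit)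

text \<open>
  The element \<open>1 + x\<close> is invertible with inverse \<open>1 - x\<close>.
\<close>
lemma null_multipliers_square_zero:
  assumes x: "x \<in> carrier R" and sq: "x \<otimes> x = \<zero>"
  shows "x \<in> null_multipliers R"
proof -
  have "(\<one> \<ominus> x) \<otimes> (\<one> \<oplus> x) = \<one> \<ominus> x \<otimes> x"
    using x by (simp add: R.minus_eq R.l_distr R.r_distr R.l_minus R.a_assoc R.r_neg2 R.r_neg1)
  then have "\<one> \<oplus> x \<in> null_multipliers R"
    using x sq by (intro null_multipliers_unit[of _ "\<one> \<ominus> x"]) (simp_all add: R.minus_eq)
  moreover have "\<ominus> \<one> \<in> null_multipliers R"
    by (rule null_multipliers_central) (simp_all add: R.l_minus R.r_minus)
  ultimately have "\<ominus> \<one> \<oplus> (\<one> \<oplus> x) \<in> null_multipliers R"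
    by (rule null_multipliers_add[rotated])
  moreover have "\<ominus> \<one> \<oplus> (\<one> \<oplus> x) = x"
    using x by algebra
  ultimately show ?thesis by simp
qed

lemma null_multipliers_corner:
  assumes "e \<in> carrier R" and "\<And>b. b \<in> carrier R \<Longrightarrow> e \<otimes> b \<otimes> e = e \<otimes> b"
  shows "e \<in> null_multipliers R"
  using assms by (auto simp: null_multipliers_iff null_polys_iff right_eval_mult_const_corner)

text \<open>
  A monomial is a constant times a power of the central indeterminate, and the indeterminate always
  preserves null polynomials.
\<close>
lemma null_polys_ideal:
  assumes all: "null_multipliers R = carrier R"
  shows "ideal (null_polys R) P"
proof (rule idealI)
  show "ring P" by (rule P.ring_axioms)
  show "subgroup (null_polys R) (add_monoid P)"
  proof (rule P.add.subgroupI)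
    show "null_polys R \<subseteq> carrier P" "null_polys R \<noteq> {}"
      using null_polys_zero null_polys_iff by blast+
    show "f \<oplus>\<^bsub>P\<^esub> g \<in> null_polys R" if "f \<in> null_polys R" "g \<in> null_polys R" for f g
      using that by (rule null_polys_add)
    show "\<ominus>\<^bsub>P\<^esub> f \<in> null_polys R" if "f \<in> null_polys R" for f
      using null_polys_left_mult[OF that, of "\<ominus>\<^bsub>P\<^esub> \<one>\<^bsub>P\<^esub>"] that
      by (simp add: null_polys_iff P.l_minus)
  qed
  show "g \<otimes>\<^bsub>P\<^esub> f \<in> null_polys R" if "f \<in> null_polys R" "g \<in> carrier P" for f g
    using that by (rule null_polys_left_mult)
  show "f \<otimes>\<^bsub>P\<^esub> g \<in> null_polys R" if f: "f \<in> null_polys R" and "g \<in> carrier P" for f g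
    using that(2)
  proof (induction g rule: poly_induct_monom)
    case zero
    then show ?case using f null_polys_zero by (simp add: null_polys_iff)
  next
    case (monom c k)
    have "f \<otimes>\<^bsub>P\<^esub> monom P c k = (f \<otimes>\<^bsub>P\<^esub> monom P c 0) \<otimes>\<^bsub>P\<^esub> monom P \<one> k"
      using f monom monom_mult[of c \<one> 0 k] by (simp add: null_polys_iff P.m_assoc)
    moreover have "f \<otimes>\<^bsub>P\<^esub> monom P c 0 \<in> null_polys R"
      using f monom all null_multipliers_iff by blast
    ultimately show ?case
      by (simp add: null_polys_iff right_eval_mult_X_pow)
  next
    case (add g h)
    then show ?case
      using f null_polys_add by (simp add: null_polys_iff P.r_distr)
  qed
qed

lemma right_eval_mult_const:
  assumes f: "f \<in> carrier P" and c: "c \<in> carrier R" and a: "a \<in> carrier R"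
  shows "right_eval R a (f \<otimes>\<^bsub>P\<^esub> monom P c 0) =
    (\<Oplus>k\<in>{..deg R f}. coeff P f k \<otimes> c \<otimes> a [^] k)"
proof -
  have co: "coeff P (f \<otimes>\<^bsub>P\<^esub> monom P c 0) k = coeff P f k \<otimes> c" for k
  proof -
    have "coeff P (f \<otimes>\<^bsub>P\<^esub> monom P c 0) k =
        (\<Oplus>i\<in>{..k}. if k = i then coeff P f i \<otimes> c else \<zero>)"
      using f c by (simp, intro R.finsum_cong') auto
    then show ?thesis
      using f c by (simp add: R.finsum_singleton)
  qed
  have "deg R (f \<otimes>\<^bsub>P\<^esub> monom P c 0) \<le> deg R f"
    using f c by (intro deg_aboveI) (simp_all add: co deg_aboveD del: coeff_mult)
  then show ?thesis
    using f c a right_eval_eq_finsum[of "f \<otimes>\<^bsub>P\<^esub> monom P c 0" a "deg R f"]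
    by (simp add: co del: coeff_mult)
qed

end

section \<open>Structural matrix rings\<close>
lemma (in abelian_monoid) finsum_swap:
  assumes "finite A" and "finite B" and f: "\<And>a b. a \<in> A \<Longrightarrow> b \<in> B \<Longrightarrow> f a b \<in> carrier G"
  shows "(\<Oplus>a\<in>A. \<Oplus>b\<in>B. f a b) = (\<Oplus>b\<in>B. \<Oplus>a\<in>A. f a b)"
  using assms(1) f
proof (induction A)
  case empty
  then show ?case by simp
next
  case (insert x A)
  have "(\<Oplus>a\<in>insert x A. \<Oplus>b\<in>B. f a b) = (\<Oplus>b\<in>B. f x b) \<oplus> (\<Oplus>b\<in>B. \<Oplus>a\<in>A. f a b)"
    using insert by (simp add: Pi_def)
  also have "\<dots> = (\<Oplus>b\<in>B. f x b \<oplus> (\<Oplus>a\<in>A. f a b))"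
    using insert.prems by (subst finsum_addf) (auto simp: Pi_def)
  also have "\<dots> = (\<Oplus>b\<in>B. \<Oplus>a\<in>insert x A. f a b)"
    using insert by (intro finsum_cong') (auto simp: Pi_def)
  finally show ?case .
qed

locale structural_matrices = R?: cring R
  for R :: "('a, 'm) ring_scheme" (structure) +
  fixes n :: nat and r :: "(nat \<times> nat) set"
  assumes preorder: "preorder_on {1..n} r"
begin

abbreviation M where "M \<equiv> struct_mat_ring n r R"

lemma r_subset: "(i, j) \<in> r \<Longrightarrow> i \<in> {1..n} \<and> j \<in> {1..n}"
  using preorder by (auto simp: preorder_on_def)

lemma r_refl: "i \<in> {1..n} \<Longrightarrow> (i, i) \<in> r"
  using preorder by (auto simp: preorder_on_def refl_on_def)

lemma r_trans: "(i, j) \<in> r \<Longrightarrow> (j, k) \<in> r \<Longrightarrow> (i, k) \<in> r"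
  using preorder by (auto simp: preorder_on_def dest: transD)

lemma finite_r: "finite r"
  using preorder unfolding preorder_on_def
  by (meson finite_SigmaI finite_atLeastAtMost finite_subset)

text \<open>
  Matrices vanish outside \<open>{1..n}\<close> and the preorder lives on \<open>{1..n}\<close>, so a single vanishing condition
  indexed by the complement of the preorder covers both cases and all indices may range freely.
\<close>
lemma mem_M_iff:
  "A \<in> carrier M \<longleftrightarrow> (\<forall>i j. A i j \<in> carrier R) \<and> (\<forall>i j. (i, j) \<notin> r \<longrightarrow> A i j = \<zero>)"
proof -
  have "A i j \<in> carrier R" if "A \<in> carrier M" for i j
    using that by (cases "i \<in> {1..n} \<and> j \<in> {1..n}")
      (auto simp: struct_mat_ring_def mat_ring_def simp del: atLeastAtMost_iff)
  moreover have "A i j = \<zero>" if "A \<in> carrier M" and "(i, j) \<notin> r" for i j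
    using that by (cases "i \<in> {1..n} \<and> j \<in> {1..n}")
      (auto simp: struct_mat_ring_def mat_ring_def simp del: atLeastAtMost_iff)
  moreover have "A \<in> carrier M"
    if "\<forall>i j. A i j \<in> carrier R" and "\<forall>i j. (i, j) \<notin> r \<longrightarrow> A i j = \<zero>"
  proof -
    have "A i j = \<zero>" if "i \<notin> {1..n} \<or> j \<notin> {1..n}" for i j
      using that \<open>\<forall>i j. (i, j) \<notin> r \<longrightarrow> A i j = \<zero>\<close> r_subset by blast
    with that show ?thesis
      by (auto simp: struct_mat_ring_def mat_ring_def simp del: atLeastAtMost_iff)
  qed
  ultimately show ?thesis by blast
qed

lemma entry_closed: "A \<in> carrier M \<Longrightarrow> A i j \<in> carrier R"
  by (simp add: mem_M_iff)

lemma entry_zero: "A \<in> carrier M \<Longrightarrow> (i, j) \<notin> r \<Longrightarrow> A i j = \<zero>"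
  by (simp add: mem_M_iff)

lemma add_entry: "(A \<oplus>\<^bsub>M\<^esub> B) i j = A i j \<oplus> B i j"
  by (simp add: struct_mat_ring_def mat_ring_def)

lemma zero_entry: "\<zero>\<^bsub>M\<^esub> i j = \<zero>"
  by (simp add: struct_mat_ring_def mat_ring_def)

lemma one_entry: "\<one>\<^bsub>M\<^esub> i j = (if i \<in> {1..n} \<and> i = j then \<one> else \<zero>)"
  by (simp add: struct_mat_ring_def mat_ring_def)

lemma mult_entry:
  assumes "A \<in> carrier M" and "B \<in> carrier M"
  shows "(A \<otimes>\<^bsub>M\<^esub> B) i j = (\<Oplus>k\<in>{1..n}. A i k \<otimes> B k j)"
proof (cases "i \<in> {1..n} \<and> j \<in> {1..n}")
  case True
  then show ?thesis by (simp add: struct_mat_ring_def mat_ring_def)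
next
  case False
  then have "A i k = \<zero> \<or> B k j = \<zero>" for k
    using assms r_subset by (meson entry_zero)
  then have "A i k \<otimes> B k j = \<zero>" for k
    using assms by (metis entry_closed R.l_null R.r_null)
  then have "(\<Oplus>k\<in>{1..n}. A i k \<otimes> B k j) = \<zero>"
    by simp
  with False show ?thesis
    by (auto simp: struct_mat_ring_def mat_ring_def)
qed

lemma mult_mem_M:
  assumes A: "A \<in> carrier M" and B: "B \<in> carrier M"
  shows "A \<otimes>\<^bsub>M\<^esub> B \<in> carrier M"
  unfolding mem_M_iff
proof (intro conjI allI impI)
  show "(A \<otimes>\<^bsub>M\<^esub> B) i j \<in> carrier R" for i j
    using A B by (simp add: mult_entry entry_closed Pi_def)
  fix i j assume "(i, j) \<notin> r"
  then have "A i k = \<zero> \<or> B k j = \<zero>" for k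
    using A B r_trans by (meson entry_zero)
  then have "A i k \<otimes> B k j = \<zero>" for k
    using A B by (metis entry_closed R.l_null R.r_null)
  then show "(A \<otimes>\<^bsub>M\<^esub> B) i j = \<zero>"
    using A B by (simp add: mult_entry)
qed

lemma mult_assoc_M:
  assumes A: "A \<in> carrier M" and B: "B \<in> carrier M" and C: "C \<in> carrier M"
  shows "A \<otimes>\<^bsub>M\<^esub> B \<otimes>\<^bsub>M\<^esub> C = A \<otimes>\<^bsub>M\<^esub> (B \<otimes>\<^bsub>M\<^esub> C)"
proof (intro ext)
  fix i j
  have "(A \<otimes>\<^bsub>M\<^esub> B \<otimes>\<^bsub>M\<^esub> C) i j = (\<Oplus>k\<in>{1..n}. (\<Oplus>l\<in>{1..n}. A i l \<otimes> B l k) \<otimes> C k j)"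
    using assms by (simp add: mult_entry mult_mem_M)
  also have "\<dots> = (\<Oplus>k\<in>{1..n}. \<Oplus>l\<in>{1..n}. A i l \<otimes> B l k \<otimes> C k j)"
    using assms by (intro R.finsum_cong') (auto simp: R.finsum_ldistr entry_closed Pi_def)
  also have "\<dots> = (\<Oplus>l\<in>{1..n}. \<Oplus>k\<in>{1..n}. A i l \<otimes> B l k \<otimes> C k j)"
    using assms by (intro R.finsum_swap) (auto simp: entry_closed)
  also have "\<dots> = (\<Oplus>l\<in>{1..n}. A i l \<otimes> (\<Oplus>k\<in>{1..n}. B l k \<otimes> C k j))"
    using assms
    by (intro R.finsum_cong') (auto simp: R.finsum_rdistr R.m_assoc entry_closed Pi_def)
  also have "\<dots> = (A \<otimes>\<^bsub>M\<^esub> (B \<otimes>\<^bsub>M\<^esub> C)) i j"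
    using assms by (simp add: mult_entry mult_mem_M)
  finally show "(A \<otimes>\<^bsub>M\<^esub> B \<otimes>\<^bsub>M\<^esub> C) i j = (A \<otimes>\<^bsub>M\<^esub> (B \<otimes>\<^bsub>M\<^esub> C)) i j" .
qed

lemma finsum_delta:
  assumes "finite I" and "\<And>i. i \<in> I \<Longrightarrow> g i \<in> carrier R"
  shows "(\<Oplus>i\<in>I. if i = k then g i else \<zero>) = (if k \<in> I then g k else \<zero>)"
proof (cases "k \<in> I")
  case True
  then show ?thesis
    using assms R.add.finprod_singleton_swap[of k I g] by (simp add: Pi_def)
next
  case False
  then have "(\<Oplus>i\<in>I. if i = k then g i else \<zero>) = \<zero>"
    by (intro R.add.finprod_one_eqI) auto
  then show ?thesis using False by simp
qed

definition diag_mat :: "nat set \<Rightarrow> 'a \<Rightarrow> nat \<Rightarrow> nat \<Rightarrow> 'a" where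
  "diag_mat S c = (\<lambda>i j. if i = j \<and> i \<in> S then c else \<zero>)"

definition mat_unit :: "nat \<Rightarrow> nat \<Rightarrow> nat \<Rightarrow> nat \<Rightarrow> 'a" where
  "mat_unit p q = (\<lambda>i j. if i = p \<and> j = q then \<one> else \<zero>)"

lemma diag_mat_mem: "S \<subseteq> {1..n} \<Longrightarrow> c \<in> carrier R \<Longrightarrow> diag_mat S c \<in> carrier M"
  using r_refl by (auto simp: mem_M_iff diag_mat_def)

lemma mat_unit_mem: "(p, q) \<in> r \<Longrightarrow> mat_unit p q \<in> carrier M"
  by (auto simp: mem_M_iff mat_unit_def)

lemma diag_mat_mult_entry:
  assumes S: "S \<subseteq> {1..n}" and c: "c \<in> carrier R" and A: "A \<in> carrier M"
  shows "(diag_mat S c \<otimes>\<^bsub>M\<^esub> A) i j = (if i \<in> S then c \<otimes> A i j else \<zero>)"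
proof -
  have "(diag_mat S c \<otimes>\<^bsub>M\<^esub> A) i j =
      (\<Oplus>k\<in>{1..n}. if k = i then (if i \<in> S then c \<otimes> A k j else \<zero>) else \<zero>)"
    unfolding mult_entry[OF diag_mat_mem[OF S c] A] using c A
    by (intro R.finsum_cong') (auto simp: diag_mat_def entry_closed)
  also have "\<dots> = (if i \<in> S then c \<otimes> A i j else \<zero>)"
    using S c A by (subst finsum_delta) (auto simp: entry_closed)
  finally show ?thesis .
qed

lemma mult_diag_mat_entry:
  assumes S: "S \<subseteq> {1..n}" and c: "c \<in> carrier R" and A: "A \<in> carrier M"
  shows "(A \<otimes>\<^bsub>M\<^esub> diag_mat S c) i j = (if j \<in> S then A i j \<otimes> c else \<zero>)"
proof -
  have "(A \<otimes>\<^bsub>M\<^esub> diag_mat S c) i j =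
      (\<Oplus>k\<in>{1..n}. if k = j then (if j \<in> S then A i k \<otimes> c else \<zero>) else \<zero>)"
    unfolding mult_entry[OF A diag_mat_mem[OF S c]] using c A
    by (intro R.finsum_cong') (auto simp: diag_mat_def entry_closed)
  also have "\<dots> = (if j \<in> S then A i j \<otimes> c else \<zero>)"
    using S c A by (subst finsum_delta) (auto simp: entry_closed)
  finally show ?thesis .
qed

lemma mat_unit_mult_entry:
  assumes pq: "(p, q) \<in> r" and A: "A \<in> carrier M"
  shows "(mat_unit p q \<otimes>\<^bsub>M\<^esub> A) i j = (if i = p then A q j else \<zero>)"
proof -
  have "(mat_unit p q \<otimes>\<^bsub>M\<^esub> A) i j =
      (\<Oplus>k\<in>{1..n}. if k = q then (if i = p then A k j else \<zero>) else \<zero>)"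
    unfolding mult_entry[OF mat_unit_mem[OF pq] A] using A
    by (intro R.finsum_cong') (auto simp: mat_unit_def entry_closed)
  also have "\<dots> = (if i = p then A q j else \<zero>)"
    using r_subset[OF pq] A by (subst finsum_delta) (auto simp: entry_closed)
  finally show ?thesis .
qed

lemma one_eq_diag_mat: "\<one>\<^bsub>M\<^esub> = diag_mat {1..n} \<one>"
  by (auto simp: one_entry diag_mat_def fun_eq_iff)

lemma ring_M: "ring M"
proof (rule ringI)
  show "abelian_group M"
  proof (rule abelian_groupI)
    show "\<exists>B\<in>carrier M. B \<oplus>\<^bsub>M\<^esub> A = \<zero>\<^bsub>M\<^esub>" if "A \<in> carrier M" for A
      using that
      by (intro bexI[of _ "\<lambda>i j. \<ominus> A i j"])
        (auto simp: fun_eq_iff add_entry zero_entry R.l_neg mem_M_iff)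
  qed (auto simp: fun_eq_iff mem_M_iff add_entry zero_entry R.a_assoc intro: R.a_comm)
  show "monoid M"
  proof (rule monoidI)
    show "\<one>\<^bsub>M\<^esub> \<in> carrier M"
      by (simp add: one_eq_diag_mat diag_mat_mem)
    fix A assume A: "A \<in> carrier M"
    have "A i j = \<zero>" if "i \<notin> {1..n} \<or> j \<notin> {1..n}" for i j
      using that A r_subset by (meson entry_zero)
    then show "\<one>\<^bsub>M\<^esub> \<otimes>\<^bsub>M\<^esub> A = A" "A \<otimes>\<^bsub>M\<^esub> \<one>\<^bsub>M\<^esub> = A"
      using A unfolding one_eq_diag_mat fun_eq_iff
      by (auto simp: diag_mat_mult_entry mult_diag_mat_entry entry_closed
          simp del: atLeastAtMost_iff)
  qed (auto simp: mult_mem_M mult_assoc_M)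
next
  fix A B C assume ABC: "A \<in> carrier M" "B \<in> carrier M" "C \<in> carrier M"
  then have AB: "A \<oplus>\<^bsub>M\<^esub> B \<in> carrier M"
    by (simp add: mem_M_iff add_entry)
  show "(A \<oplus>\<^bsub>M\<^esub> B) \<otimes>\<^bsub>M\<^esub> C = A \<otimes>\<^bsub>M\<^esub> C \<oplus>\<^bsub>M\<^esub> B \<otimes>\<^bsub>M\<^esub> C"
    using ABC AB
    by (auto simp: fun_eq_iff add_entry mult_entry entry_closed R.l_distr R.finsum_addf Pi_def)
  show "C \<otimes>\<^bsub>M\<^esub> (A \<oplus>\<^bsub>M\<^esub> B) = C \<otimes>\<^bsub>M\<^esub> A \<oplus>\<^bsub>M\<^esub> C \<otimes>\<^bsub>M\<^esub> B"
    using ABC AB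
    by (auto simp: fun_eq_iff add_entry mult_entry entry_closed R.r_distr R.finsum_addf Pi_def)
qed

sublocale M: ring M by (rule ring_M)
sublocale MP: UP_ring M "UP M" by unfold_locales

lemma finsum_entry:
  assumes "finite I" and "\<And>x. x \<in> I \<Longrightarrow> F x \<in> carrier M"
  shows "(\<Oplus>\<^bsub>M\<^esub>x\<in>I. F x) i j = (\<Oplus>x\<in>I. F x i j)"
  using assms
  by (induction I) (auto simp: zero_entry add_entry entry_closed Pi_def)

lemma minus_entry:
  assumes "A \<in> carrier M" and "B \<in> carrier M"
  shows "(A \<ominus>\<^bsub>M\<^esub> B) i j = A i j \<ominus> B i j"
proof -
  have "(\<ominus>\<^bsub>M\<^esub> B) i j \<oplus> B i j = \<zero>"
    using M.l_neg[OF assms(2)] by (simp flip: add_entry add: zero_entry)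
  then have "(\<ominus>\<^bsub>M\<^esub> B) i j = \<ominus> B i j"
    using assms by (intro R.minus_equality[symmetric]) (auto simp: entry_closed)
  then show ?thesis by (simp add: M.minus_eq R.minus_eq add_entry)
qed

section \<open>Every structural matrix is a null multiplier\<close>
definition upward_closed :: "nat set \<Rightarrow> bool" where
  "upward_closed S \<longleftrightarrow> S \<subseteq> {1..n} \<and> (\<forall>i j. i \<in> S \<longrightarrow> (i, j) \<in> r \<longrightarrow> j \<in> S)"

lemma upward_closed_up_interval: "upward_closed (up_interval n r h)"
  using r_trans r_subset unfolding upward_closed_def up_interval_def by blast

text \<open>
  Rows of a structural matrix that are indexed by \<open>S\<close> vanish at all columns outside \<open>S\<close>, which is the
  identity \<open>e b e = e b\<close> for the diagonal idempotent \<open>e\<close> of \<open>S\<close>.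
\<close>
lemma diag_mat_null_multiplier:
  assumes S: "upward_closed S"
  shows "diag_mat S \<one> \<in> null_multipliers M"
proof (rule MP.null_multipliers_corner)
  have sub: "S \<subseteq> {1..n}"
    using S by (simp add: upward_closed_def)
  then show mem: "diag_mat S \<one> \<in> carrier M"
    by (simp add: diag_mat_mem)
  fix B assume B: "B \<in> carrier M"
  have "B i j = \<zero>" if "i \<in> S" "j \<notin> S" for i j
    using that B S by (meson entry_zero upward_closed_def)
  then show "diag_mat S \<one> \<otimes>\<^bsub>M\<^esub> B \<otimes>\<^bsub>M\<^esub> diag_mat S \<one> = diag_mat S \<one> \<otimes>\<^bsub>M\<^esub> B"
    using B sub mem
    by (auto simp: fun_eq_iff mult_diag_mat_entry diag_mat_mult_entry entry_closed)
qed

lemma mat_unit_null_multiplier: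
  assumes pq: "(p, q) \<in> r"
  shows "mat_unit p q \<in> null_multipliers M"
proof -
  have off_diag: "mat_unit i j \<in> null_multipliers M" if "(i, j) \<in> r" "i \<noteq> j" for i j
  proof (rule MP.null_multipliers_square_zero)
    show mem: "mat_unit i j \<in> carrier M"
      using that by (simp add: mat_unit_mem)
    have "mat_unit i j j b = \<zero>" for b
      using that by (simp add: mat_unit_def)
    then show "mat_unit i j \<otimes>\<^bsub>M\<^esub> mat_unit i j = \<zero>\<^bsub>M\<^esub>"
      using that mem by (simp add: fun_eq_iff mat_unit_mult_entry zero_entry)
  qed
  show ?thesis
  proof (cases "p = q")
    case False
    then show ?thesis using off_diag pq by blast
  next
    case True
    have "mat_unit p p \<in> null_multipliers M"
    proof (cases "\<exists>j. j \<noteq> p \<and> (p, j) \<in> r \<and> (j, p) \<in> r")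
      case True
      then obtain j where j: "j \<noteq> p" "(p, j) \<in> r" "(j, p) \<in> r" by blast
      then have "mat_unit p p = mat_unit p j \<otimes>\<^bsub>M\<^esub> mat_unit j p"
        by (auto simp: fun_eq_iff mat_unit_mult_entry mat_unit_mem)
          (auto simp: mat_unit_def)
      then show ?thesis
        using j off_diag MP.null_multipliers_mult by simp
    next
      case False
      \<comment> \<open>Only a one-element equivalence class can be removed without spoiling upward closure.\<close>
      let ?S = "up_interval n r p"
      have up: "upward_closed (?S - {p})"
        using False r_trans r_subset unfolding upward_closed_def up_interval_def by blast
      have "p \<in> ?S"
        using r_subset[OF pq] r_refl[of p] by (simp add: up_interval_def)
      then have entry: "mat_unit p p i j = diag_mat ?S \<one> i j \<ominus> diag_mat (?S - {p}) \<one> i j" for i j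
        by (auto simp: mat_unit_def diag_mat_def R.minus_eq R.r_neg)
      have "diag_mat ?S \<one> \<in> carrier M" "diag_mat (?S - {p}) \<one> \<in> carrier M"
        by (auto intro!: diag_mat_mem simp: up_interval_def)
      then have "mat_unit p p = diag_mat ?S \<one> \<ominus>\<^bsub>M\<^esub> diag_mat (?S - {p}) \<one>"
        by (intro ext) (simp add: minus_entry entry)
      then show ?thesis
        using diag_mat_null_multiplier[OF upward_closed_up_interval[of p]]
          diag_mat_null_multiplier[OF up]
        by (simp add: M.minus_eq MP.null_multipliers_add MP.null_multipliers_minus)
    qed
    with True show ?thesis by simp
  qed
qed

lemma scalar_null_multiplier:
  assumes "c \<in> carrier R"
  shows "diag_mat {1..n} c \<in> null_multipliers M"
proof (rule MP.null_multipliers_central)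
  show "diag_mat {1..n} c \<in> carrier M"
    using assms by (simp add: diag_mat_mem)
  fix A assume A: "A \<in> carrier M"
  have "A i j = \<zero>" if "i \<notin> {1..n} \<or> j \<notin> {1..n}" for i j
    using that A r_subset by (meson entry_zero)
  then show "diag_mat {1..n} c \<otimes>\<^bsub>M\<^esub> A = A \<otimes>\<^bsub>M\<^esub> diag_mat {1..n} c"
    using A assms
    by (auto simp: fun_eq_iff diag_mat_mult_entry mult_diag_mat_entry entry_closed R.m_comm
        simp del: atLeastAtMost_iff)
qed

lemma null_multipliers_eq_carrier: "null_multipliers M = carrier M"
proof
  show "null_multipliers M \<subseteq> carrier M" by (rule MP.null_multipliers_subset)
  show "carrier M \<subseteq> null_multipliers M"
  proof
    fix A assume A: "A \<in> carrier M"
    let ?T = "\<lambda>x. diag_mat {1..n} (A (fst x) (snd x)) \<otimes>\<^bsub>M\<^esub> mat_unit (fst x) (snd x)"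
    have T: "?T x \<in> null_multipliers M" if "x \<in> r" for x
      using that A
      by (intro MP.null_multipliers_mult scalar_null_multiplier mat_unit_null_multiplier)
        (auto simp: entry_closed)
    have "(\<Oplus>\<^bsub>M\<^esub>x\<in>r. ?T x) i j = A i j" for i j
    proof -
      have "(\<Oplus>\<^bsub>M\<^esub>x\<in>r. ?T x) i j = (\<Oplus>x\<in>r. ?T x i j)"
        using T MP.null_multipliers_subset finite_r by (intro finsum_entry) blast+
      also have "\<dots> = (\<Oplus>x\<in>r. if x = (i, j) then A (fst x) (snd x) else \<zero>)"
      proof (rule R.finsum_cong')
        fix x assume "x \<in> r"
        then have "(fst x, snd x) \<in> r" by simp
        with r_subset[OF this] show
          "?T x i j = (if x = (i, j) then A (fst x) (snd x) else \<zero>)"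
          using A by (subst diag_mat_mult_entry)
            (auto simp: mat_unit_mem entry_closed prod_eq_iff, auto simp: mat_unit_def entry_closed)
      qed (use A in \<open>auto simp: entry_closed\<close>)
      also have "\<dots> = A i j"
        using A finite_r by (subst finsum_delta) (auto simp: entry_closed entry_zero)
      finally show ?thesis .
    qed
    then have "A = (\<Oplus>\<^bsub>M\<^esub>x\<in>r. ?T x)" by (simp add: fun_eq_iff)
    also have "\<dots> \<in> null_multipliers M"
      using finite_r T by (rule MP.null_multipliers_finsum)
    finally show "A \<in> null_multipliers M" .
  qed
qed

lemma null_mat_polys_eq: "null_mat_polys n r R = null_polys M"
proof -
  have "eval M M id A f = right_eval M A f" if "f \<in> carrier (UP M)" for A f
    using that by (simp only: eval_def right_eval_def restrict_apply' id_apply)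
  then show ?thesis
    unfolding null_mat_polys_def null_polys_def Let_def by auto
qed

text \<open>
  Multiplying by the matrix unit at \<open>(p, q)\<close> moves column \<open>p\<close> of the coefficients to column \<open>q\<close> and
  kills everything else, so only the row \<open>q\<close> of the powers of \<open>A\<close> survives.
\<close>
lemma null_polys_entry:
  assumes f: "f \<in> null_polys M" and pq: "(p, q) \<in> r" and A: "A \<in> carrier M"
  shows "(\<Oplus>k\<in>{..deg M f}. coeff (UP M) f k i p \<otimes> (A [^]\<^bsub>M\<^esub> k) q j) = \<zero>"
proof -
  have fP: "f \<in> carrier (UP M)"
    using f by (simp add: MP.null_polys_iff)
  let ?E = "mat_unit p q"
  have E: "?E \<in> carrier M" using pq by (rule mat_unit_mem)
  have ent: "(coeff (UP M) f k \<otimes>\<^bsub>M\<^esub> ?E \<otimes>\<^bsub>M\<^esub> A [^]\<^bsub>M\<^esub> k) i j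
      = coeff (UP M) f k i p \<otimes> (A [^]\<^bsub>M\<^esub> k) q j" for k
  proof -
    let ?F = "coeff (UP M) f k" and ?B = "A [^]\<^bsub>M\<^esub> k"
    have F: "?F \<in> carrier M" and B: "?B \<in> carrier M"
      using fP A by simp_all
    have "(?F \<otimes>\<^bsub>M\<^esub> ?E \<otimes>\<^bsub>M\<^esub> ?B) i j = (\<Oplus>l\<in>{1..n}. ?F i l \<otimes> (?E \<otimes>\<^bsub>M\<^esub> ?B) l j)"
      using F B E by (simp add: M.m_assoc mult_entry[of ?F])
    also have "\<dots> = (\<Oplus>l\<in>{1..n}. if l = p then ?F i l \<otimes> ?B q j else \<zero>)"
      using F B pq
      by (intro R.finsum_cong') (auto simp: mat_unit_mult_entry entry_closed)
    also have "\<dots> = ?F i p \<otimes> ?B q j"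
      using F B r_subset[OF pq] by (subst finsum_delta) (auto simp: entry_closed)
    finally show ?thesis .
  qed
  have "f \<otimes>\<^bsub>UP M\<^esub> monom (UP M) ?E 0 \<in> null_polys M"
    using f mat_unit_null_multiplier[OF pq] by (simp add: MP.null_multipliers_iff)
  then have "right_eval M A (f \<otimes>\<^bsub>UP M\<^esub> monom (UP M) ?E 0) = \<zero>\<^bsub>M\<^esub>"
    using A by (simp add: MP.null_polys_iff)
  then have "(\<Oplus>\<^bsub>M\<^esub>k\<in>{..deg M f}. coeff (UP M) f k \<otimes>\<^bsub>M\<^esub> ?E \<otimes>\<^bsub>M\<^esub> A [^]\<^bsub>M\<^esub> k) i j = \<zero>"
    using MP.right_eval_mult_const[OF fP E A] by (simp add: zero_entry)
  then show ?thesis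
    using fP A E by (subst (asm) finsum_entry) (simp_all add: ent)
qed

lemma right_eval_entry:
  assumes f: "f \<in> carrier (UP M)" and A: "A \<in> carrier M"
  shows "right_eval M A f i j =
    (\<Oplus>h\<in>{1..n}. \<Oplus>k\<in>{..deg M f}. coeff (UP M) f k i h \<otimes> (A [^]\<^bsub>M\<^esub> k) h j)"
proof -
  have F: "coeff (UP M) f k \<in> carrier M" and B: "A [^]\<^bsub>M\<^esub> k \<in> carrier M" for k
    using f A by simp_all
  have "right_eval M A f i j = (\<Oplus>k\<in>{..deg M f}. (coeff (UP M) f k \<otimes>\<^bsub>M\<^esub> A [^]\<^bsub>M\<^esub> k) i j)"
    unfolding right_eval_def using F B by (intro finsum_entry) auto
  also have "\<dots> = (\<Oplus>k\<in>{..deg M f}. \<Oplus>h\<in>{1..n}. coeff (UP M) f k i h \<otimes> (A [^]\<^bsub>M\<^esub> k) h j)"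
    using F B by (simp add: mult_entry)
  also have "\<dots> = (\<Oplus>h\<in>{1..n}. \<Oplus>k\<in>{..deg M f}. coeff (UP M) f k i h \<otimes> (A [^]\<^bsub>M\<^esub> k) h j)"
    using F B by (intro R.finsum_swap) (auto simp: entry_closed)
  finally show ?thesis .
qed

section \<open>Null scalar polynomials on restricted matrices\<close>
abbreviation cut :: "nat \<Rightarrow> (nat \<Rightarrow> nat \<Rightarrow> 'a) \<Rightarrow> nat \<Rightarrow> nat \<Rightarrow> 'a" where
  "cut h \<equiv> mat_restrict R (up_interval n r h)"

abbreviation Mcut :: "nat \<Rightarrow> (nat \<Rightarrow> nat \<Rightarrow> 'a) ring" where
  "Mcut h \<equiv> restricted_ring n r R h"

lemma cut_add: "A \<in> carrier M \<Longrightarrow> B \<in> carrier M \<Longrightarrow> cut h (A \<oplus>\<^bsub>M\<^esub> B) = cut h A \<oplus>\<^bsub>M\<^esub> cut h B"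
  by (auto simp: mat_restrict_def fun_eq_iff add_entry)

lemma cut_mem: "A \<in> carrier M \<Longrightarrow> cut h A \<in> carrier M"
  by (auto simp: mat_restrict_def mem_M_iff)

text \<open>
  In row \<open>i\<close> of the interval the entries of \<open>A\<close> outside the interval are already zero, so dropping the
  summands with inner index outside the interval changes nothing.
\<close>
lemma cut_mult:
  assumes A: "A \<in> carrier M" and B: "B \<in> carrier M"
  shows "cut h (A \<otimes>\<^bsub>M\<^esub> B) = cut h A \<otimes>\<^bsub>M\<^esub> cut h B"
proof (intro ext)
  fix i j
  let ?S = "up_interval n r h"
  have up: "A i k = \<zero>" if "i \<in> ?S" "k \<notin> ?S" for k
    using that A upward_closed_up_interval by (meson entry_zero upward_closed_def)
  have "(cut h A \<otimes>\<^bsub>M\<^esub> cut h B) i j = (\<Oplus>k\<in>{1..n}. cut h A i k \<otimes> cut h B k j)"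
    using A B by (simp add: mult_entry cut_mem)
  also have "\<dots> = (\<Oplus>k\<in>{1..n}. if i \<in> ?S \<and> j \<in> ?S then A i k \<otimes> B k j else \<zero>)"
    using A B up by (intro R.finsum_cong') (auto simp: mat_restrict_def entry_closed)
  also have "\<dots> = cut h (A \<otimes>\<^bsub>M\<^esub> B) i j"
    using A B by (auto simp: mat_restrict_def mult_entry)
  finally show "cut h (A \<otimes>\<^bsub>M\<^esub> B) i j = (cut h A \<otimes>\<^bsub>M\<^esub> cut h B) i j" by simp
qed

lemma cut_ring_hom: "cut h \<in> ring_hom M (Mcut h)"
  by (rule ring_hom_memI)
    (simp_all add: restricted_ring_def cut_add cut_mult)

lemma cut_ring_hom_ring: "ring_hom_ring M (Mcut h) (cut h)"
proof -
  \<comment> \<open>The restricted ring is the image of the homomorphism, and images of rings are rings.\<close>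
  have "cut h \<zero>\<^bsub>M\<^esub> = \<zero>\<^bsub>M\<^esub>"
    by (simp add: mat_restrict_def zero_entry fun_eq_iff)
  then have "(Mcut h)\<lparr>carrier := cut h ` carrier M, zero := cut h \<zero>\<^bsub>M\<^esub>\<rparr> = Mcut h"
    by (simp add: restricted_ring_def)
  then have "ring (Mcut h)"
    using M.ring_hom_imp_img_ring[OF cut_ring_hom[of h]] by simp
  then show ?thesis
    using cut_ring_hom M.ring_axioms
    by (intro ring_hom_ring.intro ring_hom_ring_axioms.intro)
qed

lemma scalar_mult_mem: "c \<in> carrier R \<Longrightarrow> A \<in> carrier M \<Longrightarrow> scalar_mult_mat R c A \<in> carrier M"
  by (auto simp: scalar_mult_mat_def mem_M_iff)

lemma scalar_poly_eval_cut:
  assumes f: "f \<in> carrier (UP R)" and A: "A \<in> carrier M"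
  shows "scalar_poly_eval n r R h (cut h A) f =
    cut h (\<Oplus>\<^bsub>M\<^esub>k\<in>{..deg R f}. scalar_mult_mat R (coeff (UP R) f k) (A [^]\<^bsub>M\<^esub> k))"
proof -
  interpret cut: ring_hom_ring M "Mcut h" "cut h" by (rule cut_ring_hom_ring)
  interpret UP_ring R "UP R" by unfold_locales
  have S: "scalar_mult_mat R (coeff (UP R) f k) (A [^]\<^bsub>M\<^esub> k) \<in> carrier M" for k
    using f A by (intro scalar_mult_mem) auto
  have "scalar_mult_mat R (coeff (UP R) f k) (cut h A [^]\<^bsub>Mcut h\<^esub> k) =
      cut h (scalar_mult_mat R (coeff (UP R) f k) (A [^]\<^bsub>M\<^esub> k))" for k
    using f unfolding cut.hom_nat_pow[OF A, symmetric]
    by (auto simp: scalar_mult_mat_def mat_restrict_def fun_eq_iff)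
  then show ?thesis
    using S by (simp add: scalar_poly_eval_def cut.hom_finsum comp_def)
qed

text \<open>
  This turns the condition on matrices cut down to \<open>[h, \<infinity>)\<close> into one on uncut matrices. The column
  index \<open>b\<close> may range freely: in a row \<open>a\<close> with \<open>h \<precsim> a\<close>, the columns outside \<open>[h, \<infinity>)\<close> hold zeros anyway.
\<close>
lemma null_scalar_polys_iff:
  "f \<in> null_scalar_polys n r R h \<longleftrightarrow> f \<in> carrier (UP R) \<and>
     (\<forall>A\<in>carrier M. \<forall>a b. (h, a) \<in> r \<longrightarrow>
        (\<Oplus>k\<in>{..deg R f}. coeff (UP R) f k \<otimes> (A [^]\<^bsub>M\<^esub> k) a b) = \<zero>)"
proof (cases "f \<in> carrier (UP R)")
  case f: True
  interpret UP_ring R "UP R" by unfold_locales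
  let ?S = "up_interval n r h"
  let ?e = "\<lambda>A a b. \<Oplus>k\<in>{..deg R f}. coeff (UP R) f k \<otimes> (A [^]\<^bsub>M\<^esub> k) a b"
  have up: "a \<in> ?S \<longleftrightarrow> (h, a) \<in> r" for a
    using r_subset by (auto simp: up_interval_def simp del: atLeastAtMost_iff)
  have null_iff: "scalar_poly_eval n r R h (cut h A) f = \<zero>\<^bsub>Mcut h\<^esub> \<longleftrightarrow>
      (\<forall>a b. (h, a) \<in> r \<longrightarrow> ?e A a b = \<zero>)" if A: "A \<in> carrier M" for A
  proof -
    have "scalar_mult_mat R (coeff (UP R) f k) (A [^]\<^bsub>M\<^esub> k) \<in> carrier M" for k
      using f A by (intro scalar_mult_mem) auto
    then have ent: "(\<Oplus>\<^bsub>M\<^esub>k\<in>{..deg R f}. scalar_mult_mat R (coeff (UP R) f k) (A [^]\<^bsub>M\<^esub> k)) a b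
        = ?e A a b" for a b
      by (simp add: finsum_entry) (simp add: scalar_mult_mat_def)
    have outside: "?e A a b = \<zero>" if "(h, a) \<in> r" "(h, b) \<notin> r" for a b
    proof -
      have "(A [^]\<^bsub>M\<^esub> k) a b = \<zero>" for k :: nat
        using that r_trans[of h a b] A by (intro entry_zero) auto
      then show ?thesis using f by simp
    qed
    have "scalar_poly_eval n r R h (cut h A) f = \<zero>\<^bsub>Mcut h\<^esub> \<longleftrightarrow>
        (\<forall>a b. (h, a) \<in> r \<and> (h, b) \<in> r \<longrightarrow> ?e A a b = \<zero>)"
      unfolding scalar_poly_eval_cut[OF f A]
      by (simp add: mat_restrict_def ent up restricted_ring_def fun_eq_iff zero_entry)
    then show ?thesis using outside by blast
  qed
  show ?thesis
    unfolding null_scalar_polys_def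
    using f null_iff by (auto simp: restricted_ring_def)
qed (simp add: null_scalar_polys_def)

section \<open>Polynomials over matrices as matrices over polynomials\<close>
lemma poly_to_mat_mem_UP:
  assumes f: "f \<in> carrier (UP M)"
  shows "poly_to_mat n r R f i j \<in> carrier (UP R)"
proof -
  interpret UP_ring R "UP R" by unfold_locales
  show ?thesis
    using MP.coeff_closed[OF f] unfolding poly_to_mat_def
    by (intro P.finsum_closed) (auto simp: entry_closed)
qed

lemma coeff_poly_to_mat:
  assumes f: "f \<in> carrier (UP M)"
  shows "coeff (UP R) (poly_to_mat n r R f i j) k = coeff (UP M) f k i j"
proof -
  interpret UP_ring R "UP R" by unfold_locales
  have F: "coeff (UP M) f l i j \<in> carrier R" for l
    using f by (simp add: entry_closed)
  have "coeff (UP R) (poly_to_mat n r R f i j) k =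
      (\<Oplus>l\<in>{..deg M f}. if l = k then coeff (UP M) f l i j else \<zero>)"
    unfolding poly_to_mat_def using F
    by (subst coeff_finsum) (auto intro!: R.finsum_cong')
  also have "\<dots> = coeff (UP M) f k i j"
    using F f by (subst finsum_delta) (auto simp: MP.deg_aboveD zero_entry)
  finally show ?thesis .
qed

lemma deg_poly_to_mat_le:
  assumes f: "f \<in> carrier (UP M)"
  shows "deg R (poly_to_mat n r R f i j) \<le> deg M f"
proof -
  interpret UP_ring R "UP R" by unfold_locales
  show ?thesis
    using f
    by (intro deg_aboveI)
      (auto simp: coeff_poly_to_mat poly_to_mat_mem_UP MP.deg_aboveD zero_entry)
qed

text \<open>
  An entry may have smaller degree than the matrix polynomial; the extra summands vanish.
\<close>
lemma finsum_coeff_poly_to_mat: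
  assumes f: "f \<in> carrier (UP M)" and B: "\<And>k. B k \<in> carrier R"
  shows "(\<Oplus>k\<in>{..deg R (poly_to_mat n r R f i j)}. coeff (UP R) (poly_to_mat n r R f i j) k \<otimes> B k)
    = (\<Oplus>k\<in>{..deg M f}. coeff (UP M) f k i j \<otimes> B k)"
proof -
  interpret UP_ring R "UP R" by unfold_locales
  show ?thesis
  proof (rule R.add.finprod_mono_neutral_cong_left)
    fix k assume "k \<in> {..deg M f} - {..deg R (poly_to_mat n r R f i j)}"
    then have "coeff (UP R) (poly_to_mat n r R f i j) k = \<zero>"
      using f by (intro deg_aboveD) (auto simp: poly_to_mat_mem_UP)
    then show "coeff (UP M) f k i j \<otimes> B k = \<zero>"
      using f B by (simp add: coeff_poly_to_mat)
  qed (use f B deg_poly_to_mat_le[OF f, of i j] in \<open>auto simp: coeff_poly_to_mat entry_closed\<close>)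
qed

lemma structural_matrices_UP: "structural_matrices (UP R) n r"
proof -
  interpret UP_cring R "UP R" by unfold_locales
  show ?thesis
    using preorder by (intro structural_matrices.intro structural_matrices_axioms.intro UP_cring)
qed

lemma poly_to_mat_image:
  "poly_to_mat n r R ` carrier (UP M) = carrier (struct_mat_ring n r (UP R))"
proof
  interpret UP_cring R "UP R" by unfold_locales
  interpret PM: structural_matrices "UP R" n r by (rule structural_matrices_UP)
  show "poly_to_mat n r R ` carrier (UP M) \<subseteq> carrier (struct_mat_ring n r (UP R))"
  proof
    fix F assume "F \<in> poly_to_mat n r R ` carrier (UP M)"
    then obtain f where f: "f \<in> carrier (UP M)" and F: "F = poly_to_mat n r R f" by blast
    have "poly_to_mat n r R f i j = \<zero>\<^bsub>UP R\<^esub>" if "(i, j) \<notin> r" for i j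
      using that f
      by (intro up_eqI) (auto simp: coeff_poly_to_mat poly_to_mat_mem_UP intro: entry_zero)
    then show "F \<in> carrier (struct_mat_ring n r (UP R))"
      using f by (simp add: F PM.mem_M_iff poly_to_mat_mem_UP)
  qed
  show "carrier (struct_mat_ring n r (UP R)) \<subseteq> poly_to_mat n r R ` carrier (UP M)"
  proof
    fix F assume F: "F \<in> carrier (struct_mat_ring n r (UP R))"
    then have Fc: "F i j \<in> carrier (UP R)" for i j
      by (rule PM.entry_closed)
    define f where "f = (\<lambda>k i j. coeff (UP R) (F i j) k)"
    define d where "d = Max ((\<lambda>x. deg R (F (fst x) (snd x))) ` r)"
    have fk: "f k \<in> carrier M" for k
      using F by (auto simp: mem_M_iff f_def Fc PM.entry_zero)
    have "f k i j = \<zero>" if "d < k" for k i j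
    proof (cases "(i, j) \<in> r")
      case True
      then have "deg R (F i j) \<le> d"
        unfolding d_def using finite_r by (intro Max_ge) force+
      then show ?thesis
        using that Fc by (simp add: f_def deg_aboveD)
    next
      case False
      then show ?thesis using fk by (simp add: entry_zero)
    qed
    then have "bound \<zero>\<^bsub>M\<^esub> d f"
      by (intro bound.intro) (simp add: fun_eq_iff zero_entry)
    then have up: "f \<in> up M"
      using fk by (intro mem_upI) blast+
    then have fM: "f \<in> carrier (UP M)" and co: "coeff (UP M) f k = f k" for k
      by (simp_all add: UP_def)
    have "coeff (UP M) f k i j = coeff (UP R) (F i j) k" for k i j
      unfolding co by (simp add: f_def)
    then have "poly_to_mat n r R f i j = F i j" for i j
      using fM Fc by (intro up_eqI) (simp_all add: coeff_poly_to_mat poly_to_mat_mem_UP)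
    then have "F = poly_to_mat n r R f"
      by (simp add: fun_eq_iff)
    then show "F \<in> poly_to_mat n r R ` carrier (UP M)"
      using fM by blast
  qed
qed

text \<open>
  Forwards, the entry condition is the one from \<open>null_polys_entry\<close>. Backwards, \<open>f(A)\<close> is assembled from the
  rows \<open>h\<close> of the values \<open>f\<^sub>i\<^sub>h(A)\<close>, and reflexivity gives \<open>h \<precsim> h\<close>.
\<close>
lemma null_polys_iff_entries:
  assumes f: "f \<in> carrier (UP M)"
  shows "f \<in> null_polys M \<longleftrightarrow>
    (\<forall>i h. (i, h) \<in> r \<longrightarrow> poly_to_mat n r R f i h \<in> null_scalar_polys n r R h)"
proof (intro iffI allI impI)
  fix i h assume null: "f \<in> null_polys M" and "(i, h) \<in> r"
  have "(\<Oplus>k\<in>{..deg M f}. coeff (UP M) f k i h \<otimes> (A [^]\<^bsub>M\<^esub> k) a b) = \<zero>"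
    if "A \<in> carrier M" "(h, a) \<in> r" for A a b
    using null that(2,1) by (rule null_polys_entry)
  then show "poly_to_mat n r R f i h \<in> null_scalar_polys n r R h"
    using f by (simp add: null_scalar_polys_iff poly_to_mat_mem_UP finsum_coeff_poly_to_mat entry_closed)
next
  assume ent: "\<forall>i h. (i, h) \<in> r \<longrightarrow> poly_to_mat n r R f i h \<in> null_scalar_polys n r R h"
  have "right_eval M A f = \<zero>\<^bsub>M\<^esub>" if A: "A \<in> carrier M" for A
  proof (intro ext)
    fix i j
    have "(\<Oplus>k\<in>{..deg M f}. coeff (UP M) f k i h \<otimes> (A [^]\<^bsub>M\<^esub> k) h j) = \<zero>"
      if h: "h \<in> {1..n}" for h
    proof (cases "(i, h) \<in> r")
      case True
      then show ?thesis
        using ent A f r_refl[OF h]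
        by (simp add: null_scalar_polys_iff finsum_coeff_poly_to_mat entry_closed)
    next
      case False
      then have "coeff (UP M) f k i h = \<zero>" for k
        using f by (simp add: entry_zero)
      then show ?thesis using A by (simp add: entry_closed)
    qed
    then show "right_eval M A f i j = \<zero>\<^bsub>M\<^esub> i j"
      unfolding right_eval_entry[OF f A] zero_entry
      by (rule R.add.finprod_one_eqI)
  qed
  then show "f \<in> null_polys M"
    using f by (simp add: MP.null_polys_iff)
qed

end

theorem corollary4p15:
  fixes R :: "('a, 'm) ring_scheme" and n :: nat and r :: "(nat \<times> nat) set"
  assumes "cring R"
    and "n \<ge> 1"
    and "preorder_on {1..n} r"
  shows "ideal (null_mat_polys n r R) (UP (struct_mat_ring n r R)) \<and>
    poly_to_mat n r R ` null_mat_polys n r R =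
      {F \<in> carrier (struct_mat_ring n r (UP R)).
        \<forall>i h. (i, h) \<in> r \<longrightarrow> F i h \<in> null_scalar_polys n r R h}"
proof -
  interpret structural_matrices R n r
    using assms by (intro structural_matrices.intro structural_matrices_axioms.intro)
  have "ideal (null_mat_polys n r R) (UP M)"
    unfolding null_mat_polys_eq by (rule MP.null_polys_ideal[OF null_multipliers_eq_carrier])
  moreover have "poly_to_mat n r R ` null_polys M =
      {F \<in> poly_to_mat n r R ` carrier (UP M).
        \<forall>i h. (i, h) \<in> r \<longrightarrow> F i h \<in> null_scalar_polys n r R h}"
    using null_polys_iff_entries MP.null_polys_iff by blast
  ultimately show ?thesis
    unfolding null_mat_polys_eq poly_to_mat_image by blast
qed

end
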